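(* Let $f_1=\cosh\chi\cos\phi$, $f_2=\cosh\chi\sin\phi$, $f_3=\sinh\chi$ on the one-sheeted hyperboloid $D^2$, and let $F_1=X_1f_1+Y_1f_2+Z_1f_3$ and $F_2=X_2f_1+Y_2f_2+Z_2f_3$, with real coefficients, be two non zero functions. If $X_1X_2+Y_1Y_2-Z_1Z_2=0$, then the lines $F_1=0$ and $F_2=0$ on the hyperboloid meet orthogonally.
   Context: $D^2=\{x^2+y^2-z^2=1\}\subset\mathbb{R}^3$ has coordinates $\chi,\phi$ given by $x=\cosh\chi\cos\phi$, $y=\cosh\chi\sin\phi$, $z=\sinh\chi$, and the indefinite metric $ds^2=-d\chi^2+\cosh^2\chi\,d\phi^2$ obtained by restricting the pseudo-metric $dx^2+dy^2-dz^2$ of $\mathbb{R}^3$. The line $F=0$ of a function $F=Xf_1+Yf_2+Zf_3$ is its zero set on $D^2$, i.e. the intersection of $D^2$ with the plane $Xx+Yy+Zz=0$ through the origin. Orthogonality of the lines is with respect to this metric.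
   Formalization: That the two lines meet is not claimed, since it can fail (x=0 and y=0 satisfy the condition but have no common point on the hyperboloid); what is proved is that the lines are orthogonal at every common point. *)

theory Defs
  imports "HOL-Analysis.Analysis"
begin

definition lorentz :: "real ^ 3 \<Rightarrow> real ^ 3 \<Rightarrow> real" where
  "lorentz u v = u $ 1 * v $ 1 + u $ 2 * v $ 2 - u $ 3 * v $ 3"

definition D2 :: "(real ^ 3) set" where
  "D2 = {p. lorentz p p = 1}"

definition hyp_point :: "real \<Rightarrow> real \<Rightarrow> real ^ 3" where
  "hyp_point chi phi = vector [cosh chi * cos phi, cosh chi * sin phi, sinh chi]"

text \<open>Functions on the hyperboloid are written in the coordinates \<open>chi\<close>, \<open>phi\<close>; those below are
  \<open>2 * pi\<close>-periodic in \<open>phi\<close>, hence well defined on \<open>D2\<close>.\<close>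

definition f1 :: "real \<Rightarrow> real \<Rightarrow> real" where "f1 chi phi = cosh chi * cos phi"
definition f2 :: "real \<Rightarrow> real \<Rightarrow> real" where "f2 chi phi = cosh chi * sin phi"
definition f3 :: "real \<Rightarrow> real \<Rightarrow> real" where "f3 chi phi = sinh chi"

definition lin_comb :: "real \<Rightarrow> real \<Rightarrow> real \<Rightarrow> real \<Rightarrow> real \<Rightarrow> real" where
  "lin_comb X Y Z = (\<lambda>chi phi. X * f1 chi phi + Y * f2 chi phi + Z * f3 chi phi)"

definition zero_line :: "(real \<Rightarrow> real \<Rightarrow> real) \<Rightarrow> (real ^ 3) set" where
  "zero_line F = {p \<in> D2. \<exists>chi phi. p = hyp_point chi phi \<and> F chi phi = 0}"

text \<open>Velocities at \<open>p\<close> of curves that stay in \<open>S\<close> near time \<open>0\<close>. If \<open>S\<close> is a regular curve near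
  \<open>p\<close>, this is its tangent line, as a linear subspace of the ambient space.\<close>

definition tangent_vectors :: "(real ^ 3) set \<Rightarrow> real ^ 3 \<Rightarrow> (real ^ 3) set" where
  "tangent_vectors S p =
     {u. \<exists>\<gamma>. \<gamma> 0 = p \<and> (\<forall>\<^sub>F t in nhds 0. \<gamma> t \<in> S) \<and> (\<gamma> has_vector_derivative u) (at (0::real))}"

text \<open>At every common point both sets have a genuine one-dimensional tangent line, and these are
  orthogonal for the metric of \<open>D2\<close>, which is the restriction of \<open>lorentz\<close>. Being about all common
  points, this does not assert that there is one: \<open>f1 = 0\<close> and \<open>f2 = 0\<close> have none on \<open>D2\<close>.
  As the metric is indefinite, a null direction is orthogonal to itself.\<close>

definition meet_orthogonally :: "(real ^ 3) set \<Rightarrow> (real ^ 3) set \<Rightarrow> bool" where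
  "meet_orthogonally A B \<longleftrightarrow>
     (\<forall>p \<in> A \<inter> B. \<exists>u v. u \<noteq> 0 \<and> v \<noteq> 0 \<and>
        tangent_vectors A p = span {u} \<and> tangent_vectors B p = span {v} \<and>
        lorentz u v = 0)"

lemma range_hyp_point: "D2 = {hyp_point chi phi | chi phi. True}"
proof (intro equalityI subsetI)
  fix p assume "p \<in> D2"
  then have eq: "(p $ 1)\<^sup>2 + (p $ 2)\<^sup>2 = 1 + (p $ 3)\<^sup>2"
    by (simp add: D2_def lorentz_def power2_eq_square)
  define chi where "chi = arsinh (p $ 3)"
  have s: "sinh chi = p $ 3" by (simp add: chi_def)
  have c: "(cosh chi)\<^sup>2 = (p $ 1)\<^sup>2 + (p $ 2)\<^sup>2"
    using eq by (simp add: cosh_square_eq s)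
  have pos: "cosh chi > 0" by (rule cosh_real_pos)
  have "(p $ 1 / cosh chi)\<^sup>2 + (p $ 2 / cosh chi)\<^sup>2 = 1"
    using c pos unfolding power_divide add_divide_distrib [symmetric] c [symmetric] by simp
  then obtain phi where "p $ 1 / cosh chi = cos phi" "p $ 2 / cosh chi = sin phi"
    by (metis sincos_total_2pi)
  then have "p $ 1 = cosh chi * cos phi" "p $ 2 = cosh chi * sin phi"
    using pos by (auto simp: field_simps)
  then have "p = hyp_point chi phi"
    by (simp add: hyp_point_def vec_eq_iff forall_3 s)
  then show "p \<in> {hyp_point chi phi | chi phi. True}" by blast
next
  fix p assume "p \<in> {hyp_point chi phi | chi phi. True}"
  then obtain chi phi where p: "p = hyp_point chi phi" by blast
  have "lorentz p p = (cosh chi)\<^sup>2 * ((cos phi)\<^sup>2 + (sin phi)\<^sup>2) - (sinh chi)\<^sup>2"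
    by (simp add: p lorentz_def hyp_point_def power2_eq_square algebra_simps
        del: sin_cos_squared_add sin_cos_squared_add2 sin_cos_squared_add3)
  then show "p \<in> D2" by (simp add: D2_def cosh_square_eq)
qed

lemma zero_line_eq_plane:
  "zero_line (lin_comb X Y Z) = D2 \<inter> {p. X * p $ 1 + Y * p $ 2 + Z * p $ 3 = 0}"
proof -
  have "lin_comb X Y Z chi phi =
      X * hyp_point chi phi $ 1 + Y * hyp_point chi phi $ 2 + Z * hyp_point chi phi $ 3" for chi phi
    by (simp add: lin_comb_def f1_def f2_def f3_def hyp_point_def)
  then show ?thesis
    unfolding zero_line_def using range_hyp_point by fastforce
qed

text \<open>In the coordinates \<open>chi\<close>, \<open>phi\<close> the restricted metric is - d chi^2 + cosh(chi)^2 d phi^2.\<close>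

lemma induced_metric:
  fixes a b :: "real \<Rightarrow> real"
  assumes "(a has_real_derivative a') (at t)" "(b has_real_derivative b') (at t)"
  obtains u where "((\<lambda>s. hyp_point (a s) (b s)) has_vector_derivative u) (at t)"
    and "lorentz u u = - a'\<^sup>2 + (cosh (a t))\<^sup>2 * b'\<^sup>2"
proof
  let ?u = "vector [sinh (a t) * a' * cos (b t) - cosh (a t) * sin (b t) * b',
                    sinh (a t) * a' * sin (b t) + cosh (a t) * cos (b t) * b',
                    cosh (a t) * a'] :: real ^ 3"
  have comp: "((\<lambda>s. hyp_point (a s) (b s) $ i) has_real_derivative ?u $ i) (at t)" for i
  proof -
    have "\<forall>i. ((\<lambda>s. hyp_point (a s) (b s) $ i) has_real_derivative ?u $ i) (at t)"
      unfolding forall_3 hyp_point_def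
      by (auto intro!: derivative_eq_intros assms simp: algebra_simps)
    then show ?thesis ..
  qed
  show "((\<lambda>s. hyp_point (a s) (b s)) has_vector_derivative ?u) (at t)"
    unfolding has_vector_derivative_def
  proof (subst has_derivative_componentwise_within, intro ballI)
    fix e :: "real ^ 3" assume "e \<in> Basis"
    then obtain i where "e = axis i 1"
      by (auto simp: Basis_vec_def)
    then show "((\<lambda>s. hyp_point (a s) (b s) \<bullet> e) has_derivative (\<lambda>x. (x *\<^sub>R ?u) \<bullet> e)) (at t)"
      using comp [of i] by (simp add: inner_axis has_field_derivative_def mult_commute_abs)
  qed
  have "lorentz ?u ?u = ((sin (b t))\<^sup>2 + (cos (b t))\<^sup>2) * ((sinh (a t))\<^sup>2 * a'\<^sup>2 + (cosh (a t))\<^sup>2 * b'\<^sup>2)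
      - (cosh (a t))\<^sup>2 * a'\<^sup>2"
    by (simp add: lorentz_def power2_eq_square algebra_simps
        del: sin_cos_squared_add sin_cos_squared_add2 sin_cos_squared_add3)
  also have "\<dots> = - a'\<^sup>2 + (cosh (a t))\<^sup>2 * b'\<^sup>2"
    by (simp add: cosh_square_eq algebra_simps)
  finally show "lorentz ?u ?u = - a'\<^sup>2 + (cosh (a t))\<^sup>2 * b'\<^sup>2" .
qed

end

theory Submission
  imports Defs
begin

text \<open>
  Write \<open>\<langle>u, v\<rangle>\<close> for \<open>lorentz u v\<close>. The plane \<open>X x + Y y + Z z = 0\<close> is the orthogonal complement,
  for this form, of the vector \<open>m = (X, Y, - Z)\<close>, and the hypothesis on the coefficients says that
  the two normals satisfy \<open>\<langle>m\<^sub>1, m\<^sub>2\<rangle> = 0\<close>.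

  Let \<open>p\<close> be a point of \<open>D2\<close> with \<open>\<langle>m, p\<rangle> = 0\<close>. Differentiating \<open>\<langle>\<gamma>, \<gamma>\<rangle> = 1\<close> and \<open>\<langle>m, \<gamma>\<rangle> = 0\<close> along
  a curve in the line shows that its velocity is orthogonal to \<open>p\<close> and to \<open>m\<close>. Conversely, a vector
  \<open>u\<close> orthogonal to both is the velocity of the radial projection to \<open>D2\<close> of the straight line
  \<open>t \<mapsto> p + t u\<close>, which does not leave the plane (\<open>tangent_vectors_plane_section\<close>). The vectors
  orthogonal to \<open>p\<close> and \<open>m\<close> are the multiples of the Lorentzian cross product \<open>p \<times> m\<close>, which is
  nonzero because \<open>\<langle>p, p\<rangle> = 1\<close> and \<open>\<langle>p, m\<rangle> = 0\<close> while \<open>m \<noteq> 0\<close> (\<open>lorentz_complement_eq_span\<close>).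

  At a common point \<open>p\<close> the two tangent lines are thus spanned by \<open>p \<times> m\<^sub>1\<close> and \<open>p \<times> m\<^sub>2\<close>, and the
  Gram identity for the cross product (\<open>lorentz_lcross_lcross\<close>) gives
  \<open>\<langle>p \<times> m\<^sub>1, p \<times> m\<^sub>2\<rangle> = \<langle>p, m\<^sub>2\<rangle> \<langle>m\<^sub>1, p\<rangle> - \<langle>p, p\<rangle> \<langle>m\<^sub>1, m\<^sub>2\<rangle> = 0\<close>.
\<close>

lemma bounded_bilinear_lorentz: "bounded_bilinear lorentz"
proof -
  have "bilinear lorentz"
    by (auto simp: bilinear_def lorentz_def linear_iff algebra_simps)
  then show ?thesis
    by (simp add: bilinear_conv_bounded_bilinear)
qed

interpretation lorentz: bounded_bilinear lorentz
  by (rule bounded_bilinear_lorentz)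

lemma lorentz_commute: "lorentz u v = lorentz v u"
  by (simp add: lorentz_def)

text \<open>The Euclidean cross product followed by the reflection \<open>z \<mapsto> - z\<close>. The reflection turns
  Euclidean into Lorentzian orthogonality to both factors.\<close>

definition lcross :: "real ^ 3 \<Rightarrow> real ^ 3 \<Rightarrow> real ^ 3" where
  "lcross u v = vector [u $ 2 * v $ 3 - u $ 3 * v $ 2, u $ 3 * v $ 1 - u $ 1 * v $ 3,
                        u $ 2 * v $ 1 - u $ 1 * v $ 2]"

lemma lorentz_lcross_left [simp]: "lorentz u (lcross u v) = 0"
  and lorentz_lcross_right [simp]: "lorentz v (lcross u v) = 0"
  by (simp_all add: lorentz_def lcross_def algebra_simps)

text \<open>Lagrange's identity. Its sign is opposite to the Euclidean one because the form has
  determinant \<open>-1\<close>.\<close>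

lemma lorentz_lcross_lcross:
  "lorentz (lcross a b) (lcross c d) = lorentz a d * lorentz b c - lorentz a c * lorentz b d"
  by (simp add: lorentz_def lcross_def algebra_simps)

lemma lcross_lcross:
  "lcross (lcross a b) c = lorentz b c *\<^sub>R a - lorentz a c *\<^sub>R b"
  by (simp add: vec_eq_iff forall_3 lorentz_def lcross_def algebra_simps)

lemma lcross_zero_left [simp]: "lcross 0 v = 0"
  by (simp add: vec_eq_iff forall_3 lcross_def)

lemma lcross_eq_0_imp_in_span:
  assumes "lcross w x = 0" "w \<noteq> 0"
  shows "x \<in> span {w}"
proof -
  have "cross3 w x = 0"
    using assms(1) by (simp add: vec_eq_iff forall_3 lcross_def cross3_def)
  then have "collinear {0, w, x}"
    by (simp add: cross_eq_0)
  then show ?thesis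
    using assms(2) by (auto simp: collinear_lemma span_singleton)
qed

text \<open>Both claims come from the triple product expansion: \<open>(p \<times> m) \<times> p\<close> is a nonzero multiple of
  \<open>m\<close>, so \<open>p \<times> m \<noteq> 0\<close>; and \<open>(p \<times> m) \<times> x\<close> vanishes when \<open>x\<close> is orthogonal to \<open>p\<close> and \<open>m\<close>, so \<open>x\<close>
  is proportional to \<open>p \<times> m\<close>.\<close>

lemma lorentz_complement_eq_span:
  assumes "lorentz p p \<noteq> 0" "lorentz m p = 0" "m \<noteq> 0"
  shows "lcross p m \<noteq> 0"
    and "{x. lorentz p x = 0 \<and> lorentz m x = 0} = span {lcross p m}"
proof -
  have "lcross (lcross p m) p = - (lorentz p p *\<^sub>R m)"
    by (simp add: lcross_lcross assms(2))
  then show nz: "lcross p m \<noteq> 0"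
    using assms(1,3) by auto
  show "{x. lorentz p x = 0 \<and> lorentz m x = 0} = span {lcross p m}"
  proof (intro equalityI subsetI)
    fix x assume "x \<in> {x. lorentz p x = 0 \<and> lorentz m x = 0}"
    then have "lcross (lcross p m) x = 0"
      by (simp add: lcross_lcross)
    then show "x \<in> span {lcross p m}"
      using nz by (rule lcross_eq_0_imp_in_span)
  next
    fix x assume "x \<in> span {lcross p m}"
    then show "x \<in> {x. lorentz p x = 0 \<and> lorentz m x = 0}"
      by (auto simp: span_singleton lorentz.scaleR_right)
  qed
qed

lemma derivative_eq_0_if_locally_constant:
  fixes f :: "real \<Rightarrow> real"
  assumes "(f has_vector_derivative d) (at a)" "\<forall>\<^sub>F t in nhds a. f t = c"
  shows "d = 0"
proof -
  have "(f has_real_derivative d) (at a)"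
    using assms(1) by (simp add: has_real_derivative_iff_has_vector_derivative)
  then have "((\<lambda>t. c) has_real_derivative d) (at a)"
    using DERIV_cong_ev [OF refl assms(2) refl] by simp
  then show ?thesis
    using DERIV_const DERIV_unique by blast
qed

text \<open>The two defining equations bound the velocities from above by differentiation. For the converse,
  the plane is a linear subspace, so dividing \<open>p + t u\<close> by its Lorentzian length brings it back to
  \<open>D2\<close> inside the plane; this length is constant to first order because \<open>u\<close> is orthogonal to \<open>p\<close>.\<close>

lemma tangent_vectors_plane_section:
  assumes p: "p \<in> D2" and mp: "lorentz m p = 0"
  shows "tangent_vectors (D2 \<inter> {q. lorentz m q = 0}) p = {u. lorentz p u = 0 \<and> lorentz m u = 0}"
    (is "tangent_vectors ?L p = _")
proof (intro equalityI subsetI)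
  fix u assume "u \<in> tangent_vectors ?L p"
  then obtain \<gamma> where g0: "\<gamma> 0 = p" and ev: "\<forall>\<^sub>F t in nhds 0. \<gamma> t \<in> ?L"
    and der: "(\<gamma> has_vector_derivative u) (at (0::real))"
    unfolding tangent_vectors_def by blast
  have "((\<lambda>t. lorentz (\<gamma> t) (\<gamma> t)) has_vector_derivative lorentz (\<gamma> 0) u + lorentz u (\<gamma> 0)) (at 0)"
    by (rule lorentz.has_vector_derivative [OF der der])
  moreover have "\<forall>\<^sub>F t in nhds 0. lorentz (\<gamma> t) (\<gamma> t) = 1"
    using ev by eventually_elim (simp add: D2_def)
  ultimately have "lorentz (\<gamma> 0) u + lorentz u (\<gamma> 0) = 0"
    by (rule derivative_eq_0_if_locally_constant)
  then have "lorentz p u = 0"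
    by (simp add: g0 lorentz_commute [of u])
  moreover have "lorentz m u = 0"
  proof (rule derivative_eq_0_if_locally_constant)
    show "((\<lambda>t. lorentz m (\<gamma> t)) has_vector_derivative lorentz m u) (at 0)"
      by (rule bounded_linear.has_vector_derivative [OF lorentz.bounded_linear_right der])
    show "\<forall>\<^sub>F t in nhds 0. lorentz m (\<gamma> t) = 0"
      using ev by eventually_elim simp
  qed
  ultimately show "u \<in> {u. lorentz p u = 0 \<and> lorentz m u = 0}"
    by simp
next
  fix u assume "u \<in> {u. lorentz p u = 0 \<and> lorentz m u = 0}"
  then have pu: "lorentz p u = 0" and mu: "lorentz m u = 0"
    by simp_all
  have pp: "lorentz p p = 1"
    using p by (simp add: D2_def)
  define N where "N t = 1 + t\<^sup>2 * lorentz u u" for t :: real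
  define \<gamma> where "\<gamma> t = (1 / sqrt (N t)) *\<^sub>R (p + t *\<^sub>R u)" for t :: real
  have N: "lorentz (p + t *\<^sub>R u) (p + t *\<^sub>R u) = N t" for t
    by (simp add: N_def lorentz.add_left lorentz.add_right lorentz.scaleR_left lorentz.scaleR_right
        pp pu lorentz_commute [of u p] power2_eq_square)
  \<comment> \<open>For timelike \<open>u\<close> the straight line stays in the region where \<open>lorentz\<close> is positive only for
    small times.\<close>
  have "isCont N 0"
    unfolding N_def by (intro continuous_intros)
  then have "(N \<longlongrightarrow> N 0) (nhds 0)"
    by (simp add: isCont_def tendsto_at_iff_tendsto_nhds)
  then have "\<forall>\<^sub>F t in nhds 0. N t > 0"
    by (rule order_tendstoD) (simp add: N_def)
  then have "\<forall>\<^sub>F t in nhds 0. \<gamma> t \<in> ?L"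
  proof eventually_elim
    case (elim t)
    then have "lorentz (\<gamma> t) (\<gamma> t) = 1"
      by (simp add: \<gamma>_def lorentz.scaleR_left lorentz.scaleR_right N)
    moreover have "lorentz m (\<gamma> t) = 0"
      by (simp add: \<gamma>_def lorentz.add_right lorentz.scaleR_right mp mu)
    ultimately show ?case
      by (simp add: D2_def)
  qed
  moreover have "(\<gamma> has_vector_derivative u) (at 0)"
  proof -
    \<comment> \<open>The scaling factor has derivative \<open>0\<close> because \<open>N\<close> has no linear term.\<close>
    have "((\<lambda>t. 1 / sqrt (N t)) has_real_derivative 0) (at 0)"
      unfolding N_def by (auto intro!: derivative_eq_intros)
    moreover have "((\<lambda>t. p + t *\<^sub>R u) has_vector_derivative u) (at 0)"
      by (auto intro!: derivative_eq_intros)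
    ultimately have "(\<gamma> has_vector_derivative (1 / sqrt (N 0)) *\<^sub>R u + 0 *\<^sub>R (p + 0 *\<^sub>R u)) (at 0)"
      unfolding \<gamma>_def by (rule has_vector_derivative_scaleR)
    then show ?thesis
      by (simp add: N_def)
  qed
  moreover have "\<gamma> 0 = p"
    by (simp add: \<gamma>_def N_def)
  ultimately show "u \<in> tangent_vectors ?L p"
    unfolding tangent_vectors_def by blast
qed

lemma zero_line_eq_plane_section:
  "zero_line (lin_comb X Y Z) = D2 \<inter> {q. lorentz (vector [X, Y, - Z]) q = 0}"
  by (simp add: zero_line_eq_plane lorentz_def)

lemma normal_nonzero:
  assumes "lin_comb X Y Z \<noteq> (\<lambda>chi phi. 0)"
  shows "(vector [X, Y, - Z] :: real ^ 3) \<noteq> 0"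
proof
  assume "(vector [X, Y, - Z] :: real ^ 3) = 0"
  then have "X = 0 \<and> Y = 0 \<and> Z = 0"
    by (simp add: vec_eq_iff forall_3)
  then show False
    using assms by (simp add: lin_comb_def)
qed

theorem proposition2p4:
  fixes X1 Y1 Z1 X2 Y2 Z2 :: real
  assumes "lin_comb X1 Y1 Z1 \<noteq> (\<lambda>chi phi. 0)"
    and "lin_comb X2 Y2 Z2 \<noteq> (\<lambda>chi phi. 0)"
    and "X1 * X2 + Y1 * Y2 - Z1 * Z2 = 0"
  shows "meet_orthogonally (zero_line (lin_comb X1 Y1 Z1)) (zero_line (lin_comb X2 Y2 Z2))"
proof -
  define m1 :: "real ^ 3" where "m1 = vector [X1, Y1, - Z1]"
  define m2 :: "real ^ 3" where "m2 = vector [X2, Y2, - Z2]"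
  have nz: "m1 \<noteq> 0" "m2 \<noteq> 0"
    unfolding m1_def m2_def using assms(1,2) by (simp_all only: normal_nonzero not_False_eq_True)
  have m12: "lorentz m1 m2 = 0"
    using assms(3) by (simp add: m1_def m2_def lorentz_def)
  show ?thesis
    unfolding meet_orthogonally_def zero_line_eq_plane_section m1_def [symmetric] m2_def [symmetric]
  proof (intro ballI exI conjI)
    fix p assume "p \<in> D2 \<inter> {q. lorentz m1 q = 0} \<inter> (D2 \<inter> {q. lorentz m2 q = 0})"
    then have p: "p \<in> D2" and m: "lorentz m1 p = 0" "lorentz m2 p = 0"
      by auto
    then have pp: "lorentz p p \<noteq> 0"
      by (simp add: D2_def)
    show "lcross p m1 \<noteq> 0" "lcross p m2 \<noteq> 0"
      by (rule lorentz_complement_eq_span(1); fact pp m nz)+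
    show "tangent_vectors (D2 \<inter> {q. lorentz m1 q = 0}) p = span {lcross p m1}"
      using tangent_vectors_plane_section [OF p m(1)]
        lorentz_complement_eq_span(2) [OF pp m(1) nz(1)] by simp
    show "tangent_vectors (D2 \<inter> {q. lorentz m2 q = 0}) p = span {lcross p m2}"
      using tangent_vectors_plane_section [OF p m(2)]
        lorentz_complement_eq_span(2) [OF pp m(2) nz(2)] by simp
    show "lorentz (lcross p m1) (lcross p m2) = 0"
      by (simp add: lorentz_lcross_lcross m m12)
  qed
qed

end
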